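(* Let $N,p\in\mathbb{N}$. For each one of the following sets $U_i$, there exist a neural network $f$ on $\mathbb{R}^N$ with at most two layers (with continuous piecewise affine activation functions), given by its weight matrices $W=(W^1,W^2)$ and bias terms $b^1,b^2$, a norm $\|\cdot\|$ on its output space, a center point $\bar c$ in its output space and a radius $R\ge 0$, such that $U_f(W,\bar c,R)=U_i$: (i) $U_1=\{c\in\mathbb{R}^N : (c-a)^\top\Sigma(c-a)\le 1\}$, where $\Sigma\in\mathbb{R}^{N\times N}$ is a symmetric positive definite matrix and $a\in\mathbb{R}^N$; (ii) $U_2=\{c\in\mathbb{R}^N : Ac\le b\}$, where $A\in\mathbb{R}^{p\times N}$ and $b\in\mathbb{R}^p$; (iii) $U_3=\{c\in\{0,1\}^N : Ac=b\}$, where $A\in\mathbb{R}^{p\times N}$ and $b\in\mathbb{R}^p$.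
   Context: Neural network with bias terms: a network with $L$ layers on $\mathbb{R}^N$ is the map $f=f_L\circ\cdots\circ f_1$ with $f_l(y)=\sigma^l(W^ly+b^l)$, where $W^l\in\mathbb{R}^{d_l\times d_{l-1}}$, $b^l\in\mathbb{R}^{d_l}$, $d_0=N$ and arbitrary widths $d_1,\ldots,d_L$, and where $\sigma^l:\mathbb{R}\to\mathbb{R}$ is applied componentwise. "At most two layers" means $L\in\{1,2\}$ (for $L=1$ only $W^1,b^1$ are present). Activation functions: each $\sigma^l$ is continuous and piecewise affine with finitely many pieces, i.e. there are finitely many intervals covering $\mathbb{R}$, consecutive ones sharing an endpoint, on each of which $\sigma^l$ is affine. The activation functions may be chosen as part of the network. For a norm $\|\cdot\|$ on $\mathbb{R}^{d_L}$, $\bar c\in\mathbb{R}^{d_L}$ and $R\ge 0$, $U_f(W,\bar c,R)=\{c\in\mathbb{R}^N : \|f(c)-\bar c\|\le R\}$. *)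

theory Defs
  imports
    Complex_Main
    "HOL-Library.Extended_Real"
    "Jordan_Normal_Form.Matrix"
begin

definition affine_fun_on :: "real set \<Rightarrow> (real \<Rightarrow> real) \<Rightarrow> bool" where
  "affine_fun_on I s \<longleftrightarrow> (\<exists>m q. \<forall>x\<in>I. s x = m * x + q)"

(* The endpoints t 0 = -\<infinity> < t 1 < ... < t n = \<infinity> give n closed pieces covering the real line. *)
definition piecewise_affine :: "(real \<Rightarrow> real) \<Rightarrow> bool" where
  "piecewise_affine s \<longleftrightarrow>
     (\<exists>(n :: nat) (t :: nat \<Rightarrow> ereal).
        t 0 = - \<infinity> \<and> t n = \<infinity> \<and>
        (\<forall>i<n. t i < t (Suc i) \<and>
               affine_fun_on {x. t i \<le> ereal x \<and> ereal x \<le> t (Suc i)} s))"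

datatype layer =
  Layer (activation: "real \<Rightarrow> real") (weights: "real mat") (bias: "real vec")

abbreviation width :: "layer \<Rightarrow> nat" where
  "width l \<equiv> dim_vec (bias l)"

definition layer_fun :: "layer \<Rightarrow> real vec \<Rightarrow> real vec" where
  "layer_fun l y = map_vec (activation l) (weights l *\<^sub>v y + bias l)"

(* The list of layers starts with the one applied first. *)
definition network_fun :: "layer list \<Rightarrow> real vec \<Rightarrow> real vec" where
  "network_fun ls = fold layer_fun ls"

(* is_network n ls d: the layers ls form a network from R^n to R^d.
   Widths are required to be positive; only the input dimension may be 0. *)
fun is_network :: "nat \<Rightarrow> layer list \<Rightarrow> nat \<Rightarrow> bool" where
  "is_network n [] d \<longleftrightarrow> n = d"
| "is_network n (l # ls) d \<longleftrightarrow>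
     0 < width l \<and> weights l \<in> carrier_mat (width l) n \<and>
     continuous_on UNIV (activation l) \<and> piecewise_affine (activation l) \<and>
     is_network (width l) ls d"

definition is_norm :: "nat \<Rightarrow> (real vec \<Rightarrow> real) \<Rightarrow> bool" where
  "is_norm d \<nu> \<longleftrightarrow>
     (\<forall>x\<in>carrier_vec d. 0 \<le> \<nu> x \<and> (\<nu> x = 0 \<longleftrightarrow> x = 0\<^sub>v d)) \<and>
     (\<forall>r. \<forall>x\<in>carrier_vec d. \<nu> (r \<cdot>\<^sub>v x) = \<bar>r\<bar> * \<nu> x) \<and>
     (\<forall>x\<in>carrier_vec d. \<forall>y\<in>carrier_vec d. \<nu> (x + y) \<le> \<nu> x + \<nu> y)"

definition network_set ::
  "nat \<Rightarrow> layer list \<Rightarrow> (real vec \<Rightarrow> real) \<Rightarrow> real vec \<Rightarrow> real \<Rightarrow> real vec set" where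
  "network_set n ls \<nu> cbar R = {c \<in> carrier_vec n. \<nu> (network_fun ls c - cbar) \<le> R}"

definition two_layer_representable :: "nat \<Rightarrow> real vec set \<Rightarrow> bool" where
  "two_layer_representable n U \<longleftrightarrow>
     (\<exists>ls d \<nu> cbar R.
        length ls \<in> {1, 2} \<and> is_network n ls d \<and> is_norm d \<nu> \<and>
        cbar \<in> carrier_vec d \<and> 0 \<le> R \<and> network_set n ls \<nu> cbar R = U)"

definition sym_pos_def :: "nat \<Rightarrow> real mat \<Rightarrow> bool" where
  "sym_pos_def n S \<longleftrightarrow>
     S \<in> carrier_mat n n \<and> transpose_mat S = S \<and>
     (\<forall>x\<in>carrier_vec n. x \<noteq> 0\<^sub>v n \<longrightarrow> 0 < x \<bullet> (S *\<^sub>v x))"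

end

theory Submission
  imports Defs
begin

text \<open>One layer is enough in all three cases. An ellipsoid is a ball of the norm
  \<open>sqrt (x \<bullet> S x)\<close> after the identity layer. The other two sets are the zero set of a layer, that is,
  the preimage of a ball of radius \<open>0\<close>: \<open>max 0\<close> vanishes exactly on the nonpositive reals, and
  \<open>s x = \<bar>x - 1/2\<bar> - 1/2\<close> vanishes exactly at \<open>0\<close> and \<open>1\<close>. The same \<open>s\<close> also expresses an
  equation \<open>r = 0\<close>, namely as \<open>s r = 0\<close> and \<open>s (- r) = 0\<close>.\<close>

text \<open>Every activation function used below has at most one kink, so the breakpoints
  -\<infinity>, \<open>u\<close>, \<infinity> suffice.\<close>

lemma piecewise_affine_two_pieces:
  assumes "affine_fun_on {..u} s" "affine_fun_on {u..} s"
  shows "piecewise_affine s"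
proof -
  define t :: "nat \<Rightarrow> ereal" where
    "t i = (if i = 0 then - \<infinity> else if i = 1 then ereal u else \<infinity>)" for i
  have "t i < t (Suc i) \<and> affine_fun_on {x. t i \<le> ereal x \<and> ereal x \<le> t (Suc i)} s" if "i < 2" for i
  proof -
    from that consider "i = 0" | "i = 1"
      by linarith
    then show ?thesis
      by cases (use assms in \<open>auto simp: t_def atMost_def atLeast_def\<close>)
  qed
  moreover have "t 0 = - \<infinity>" "t 2 = \<infinity>"
    by (simp_all add: t_def)
  ultimately show ?thesis
    unfolding piecewise_affine_def by blast
qed

lemma piecewise_affine_ident: "piecewise_affine (\<lambda>x. x)"
proof -
  have "affine_fun_on I (\<lambda>x. x)" for I
    unfolding affine_fun_on_def by (rule exI[of _ 1], rule exI[of _ 0]) auto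
  then show ?thesis
    using piecewise_affine_two_pieces by blast
qed

lemma piecewise_affine_max_0: "piecewise_affine (max 0)"
proof (rule piecewise_affine_two_pieces[of 0])
  show "affine_fun_on {..0} (max 0)"
    unfolding affine_fun_on_def by (rule exI[of _ 0], rule exI[of _ 0]) auto
  show "affine_fun_on {0..} (max 0)"
    unfolding affine_fun_on_def by (rule exI[of _ 1], rule exI[of _ 0]) auto
qed

lemma continuous_on_max_0: "continuous_on UNIV (max (0 :: real))"
  by (intro continuous_intros)

lemma piecewise_affine_abs: "piecewise_affine (\<lambda>x. \<bar>x - u\<bar> - v)"
proof (rule piecewise_affine_two_pieces[of u])
  show "affine_fun_on {..u} (\<lambda>x. \<bar>x - u\<bar> - v)"
    unfolding affine_fun_on_def by (rule exI[of _ "-1"], rule exI[of _ "u - v"]) auto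
  show "affine_fun_on {u..} (\<lambda>x. \<bar>x - u\<bar> - v)"
    unfolding affine_fun_on_def by (rule exI[of _ 1], rule exI[of _ "- u - v"]) auto
qed

lemma sum_abs_le_0_iff: "(\<Sum>i<k. \<bar>f i\<bar>) \<le> 0 \<longleftrightarrow> (\<forall>i<k. f i = 0)"
  for f :: "nat \<Rightarrow> real"
proof -
  have "(\<Sum>i<k. \<bar>f i\<bar>) \<le> 0 \<longleftrightarrow> (\<Sum>i<k. \<bar>f i\<bar>) = 0"
    using sum_nonneg[of "{..<k}" "\<lambda>i. \<bar>f i\<bar>"] by linarith
  then show ?thesis
    by (simp add: sum_nonneg_eq_0_iff Ball_def)
qed

text \<open>The l1 norm serves the sets cut out with radius 0: by \<open>sum_abs_le_0_iff\<close>,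
  the bound on the norm becomes the conjunction of one equation per neuron.\<close>

lemma is_norm_l1: "is_norm d (\<lambda>x. \<Sum>i<d. \<bar>x $ i\<bar>)"
  unfolding is_norm_def
  by (auto simp: sum_nonneg sum_nonneg_eq_0_iff sum_distrib_left abs_mult simp flip: sum.distrib
      intro!: sum_mono)

text \<open>The bilinear form \<open>B x y\<close> is an inner product, so its root is a norm; the
  triangle inequality comes from Cauchy-Schwarz (\<open>CS\<close>).\<close>

lemma is_norm_sym_pos_def:
  assumes S: "sym_pos_def n S"
  shows "is_norm n (\<lambda>x. sqrt (x \<bullet> (S *\<^sub>v x)))"
proof -
  define B where "B x y = x \<bullet> (S *\<^sub>v y)" for x y :: "real vec"
  note [simp] = sym_pos_def_def
  have Sc: "S \<in> carrier_mat n n" and St: "transpose_mat S = S"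
    using S by auto
  note Sv = mult_mat_vec_carrier[OF Sc]
  have B_sym: "B x y = B y x" if "x \<in> carrier_vec n" "y \<in> carrier_vec n" for x y
    using transpose_vec_mult_scalar[OF Sc that(2,1)] St that Sv
    by (simp add: B_def comm_scalar_prod[of y n])
  have B_add: "B x (y + z) = B x y + B x z"
    if "x \<in> carrier_vec n" "y \<in> carrier_vec n" "z \<in> carrier_vec n" for x y z
    using that Sv by (simp add: B_def mult_add_distrib_mat_vec[OF Sc] scalar_prod_add_distrib)
  have B_smult: "B x (r \<cdot>\<^sub>v y) = r * B x y" if "x \<in> carrier_vec n" "y \<in> carrier_vec n" for x y r
    using that Sv by (simp add: B_def mult_mat_vec[OF Sc])
  have B_expand: "B (x + r \<cdot>\<^sub>v y) (x + r \<cdot>\<^sub>v y) = B x x + 2 * r * B x y + r\<^sup>2 * B y y"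
    if "x \<in> carrier_vec n" "y \<in> carrier_vec n" for x y r
    \<comment> \<open>Linearity is established in the second argument only; symmetry transfers it to
      the first.\<close>
    using that B_sym[of "x + r \<cdot>\<^sub>v y"] B_sym[of y x]
    by (simp add: B_add B_smult power2_eq_square algebra_simps)
  have B_zero: "B (0\<^sub>v n) (0\<^sub>v n) = 0"
    using Sv by (simp add: B_def)
  have B_pos: "0 < B x x" if "x \<in> carrier_vec n" "x \<noteq> 0\<^sub>v n" for x
    using S that by (simp add: B_def)
  have B_nonneg: "0 \<le> B x x" if "x \<in> carrier_vec n" for x
    using B_pos[OF that] B_zero by (cases "x = 0\<^sub>v n") auto
  have CS: "B x y \<le> sqrt (B x x) * sqrt (B y y)"
    if x: "x \<in> carrier_vec n" and y: "y \<in> carrier_vec n" for x y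
  proof (cases "y = 0\<^sub>v n")
    case True
    then have "0 \<cdot>\<^sub>v y = y"
      by auto
    then have "B x y = 0"
      using B_smult[OF x y, of 0] by simp
    then show ?thesis
      by (simp add: B_nonneg x y)
  next
    case False
    then have pos: "0 < B y y"
      using B_pos y by blast
    \<comment> \<open>The coefficient \<open>- B x y / B y y\<close> minimizes the quadratic
      \<open>r \<mapsto> B (x + r \<cdot>\<^sub>v y) (x + r \<cdot>\<^sub>v y)\<close>;
      nonnegativity of the minimum is Cauchy-Schwarz.\<close>
    have "0 \<le> B x x + 2 * (- B x y / B y y) * B x y + (- B x y / B y y)\<^sup>2 * B y y"
      using B_nonneg[of "x + (- B x y / B y y) \<cdot>\<^sub>v y"] B_expand[OF x y] x y by simp
    also have "\<dots> = B x x - (B x y)\<^sup>2 / B y y"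
      using pos by (simp add: field_simps power2_eq_square)
    finally have "(B x y)\<^sup>2 \<le> B x x * B y y"
      using pos by (simp add: field_simps)
    then show ?thesis
      by (metis real_le_rsqrt real_sqrt_mult)
  qed
  have "sqrt (B (x + y) (x + y)) \<le> sqrt (B x x) + sqrt (B y y)"
    if x: "x \<in> carrier_vec n" and y: "y \<in> carrier_vec n" for x y
  proof (rule real_le_lsqrt)
    \<comment> \<open>After squaring, this is the expansion at \<open>r = 1\<close> with the cross
      term bounded by \<open>CS\<close>.\<close>
    show "B (x + y) (x + y) \<le> (sqrt (B x x) + sqrt (B y y))\<^sup>2"
      using B_expand[OF x y, of 1] CS[OF x y] x y by (simp add: power2_sum B_nonneg)
  qed (simp add: B_nonneg x y)
  moreover have "sqrt (B (r \<cdot>\<^sub>v x) (r \<cdot>\<^sub>v x)) = \<bar>r\<bar> * sqrt (B x x)" if "x \<in> carrier_vec n" for r x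
    using that B_sym[of "r \<cdot>\<^sub>v x" x] by (simp add: B_smult real_sqrt_mult flip: mult.assoc)
  moreover have "sqrt (B x x) = 0 \<longleftrightarrow> x = 0\<^sub>v n" if "x \<in> carrier_vec n" for x
    using B_pos[OF that] B_zero by (cases "x = 0\<^sub>v n") auto
  ultimately show ?thesis
    unfolding is_norm_def B_def[symmetric] by (simp add: B_nonneg)
qed

lemma two_layer_representable_one_layer:
  assumes "0 < d" "W \<in> carrier_mat d n" "q \<in> carrier_vec d"
    and "continuous_on UNIV s" "piecewise_affine s"
    and "is_norm d \<nu>" "cbar \<in> carrier_vec d" "0 \<le> R"
  shows "two_layer_representable n {c \<in> carrier_vec n. \<nu> (map_vec s (W *\<^sub>v c + q) - cbar) \<le> R}"
  unfolding two_layer_representable_def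
  using assms
  by (intro exI[of _ "[Layer s W q]"] exI[of _ d] exI[of _ \<nu>] exI[of _ cbar] exI[of _ R])
    (auto simp: network_set_def network_fun_def layer_fun_def)

text \<open>Widths are positive, so an empty system needs a dummy neuron.\<close>

lemma two_layer_representable_UNIV: "two_layer_representable n (carrier_vec n)"
proof -
  have "two_layer_representable n {c \<in> carrier_vec n.
      (\<Sum>i<1. \<bar>(map_vec (max 0) (0\<^sub>m 1 n *\<^sub>v c + 0\<^sub>v 1) - 0\<^sub>v 1) $ i\<bar>) \<le> 0}"
    by (rule two_layer_representable_one_layer[OF _ _ _ _ _ is_norm_l1])
      (simp_all add: piecewise_affine_max_0 continuous_on_max_0)
  then show ?thesis
    by (simp cong: conj_cong)
qed

text \<open>Each pair in \<open>ws\<close> becomes one neuron with its weights and bias, and the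
  output lies in the l1 ball of radius 0 about the origin iff all neurons vanish. A list lets
  constraints of different kinds be appended.\<close>

lemma two_layer_representable_zero_set:
  assumes s: "continuous_on UNIV s" "piecewise_affine s"
    and ws: "fst ` set ws \<subseteq> carrier_vec n"
  shows "two_layer_representable n {c \<in> carrier_vec n. \<forall>(w, q) \<in> set ws. s (w \<bullet> c + q) = 0}"
proof (cases "ws = []")
  case True
  then show ?thesis
    using two_layer_representable_UNIV by simp
next
  case False
  define k where "k = length ws"
  define W where "W = mat_of_rows n (map fst ws)"
  define q where "q = vec_of_list (map snd ws)"
  \<comment> \<open>\<open>mat_of_rows\<close> reads the first \<open>n\<close> entries of each
    vector; by \<open>ws\<close> these are all its entries.\<close>
  have rows: "(W *\<^sub>v c + q) $ i = fst (ws ! i) \<bullet> c + snd (ws ! i)" if "i < k" for c i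
    using that ws by (auto simp: W_def q_def k_def vec_of_list_index subset_iff)
  have dim: "W \<in> carrier_mat k n" "q \<in> carrier_vec k"
    by (auto simp: W_def q_def k_def intro!: carrier_vecI)
  have "two_layer_representable n {c \<in> carrier_vec n.
      (\<Sum>i<k. \<bar>(map_vec s (W *\<^sub>v c + q) - 0\<^sub>v k) $ i\<bar>) \<le> 0}"
    using False dim s
    by (intro two_layer_representable_one_layer[OF _ _ _ _ _ is_norm_l1]) (auto simp: k_def)
  moreover have "(\<Sum>i<k. \<bar>(map_vec s (W *\<^sub>v c + q) - 0\<^sub>v k) $ i\<bar>) \<le> 0 \<longleftrightarrow>
      (\<forall>(w, q) \<in> set ws. s (w \<bullet> c + q) = 0)" for c
  proof -
    have "(\<Sum>i<k. \<bar>(map_vec s (W *\<^sub>v c + q) - 0\<^sub>v k) $ i\<bar>) =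
        (\<Sum>i<k. \<bar>s (fst (ws ! i) \<bullet> c + snd (ws ! i))\<bar>)"
      using dim rows by (intro sum.cong) auto
    also have "\<dots> \<le> 0 \<longleftrightarrow> (\<forall>i<k. s (fst (ws ! i) \<bullet> c + snd (ws ! i)) = 0)"
      by (simp add: sum_abs_le_0_iff)
    also have "\<dots> \<longleftrightarrow> (\<forall>(w, q) \<in> set ws. s (w \<bullet> c + q) = 0)"
      unfolding k_def by (auto simp: all_set_conv_all_nth split_beta)
    finally show ?thesis .
  qed
  ultimately show ?thesis
    by simp
qed

lemma two_layer_representable_ellipsoid:
  assumes S: "sym_pos_def N S" and a: "a \<in> carrier_vec N"
  shows "two_layer_representable N {c \<in> carrier_vec N. (c - a) \<bullet> (S *\<^sub>v (c - a)) \<le> 1}"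
proof (cases "N = 0")
  case True
  \<comment> \<open>In dimension 0 the identity layer would have width 0. The quadratic form is then
    0, so the set is the whole space.\<close>
  then have "{c \<in> carrier_vec N. (c - a) \<bullet> (S *\<^sub>v (c - a)) \<le> 1} = carrier_vec N"
    using S by (auto simp: scalar_prod_def sym_pos_def_def)
  then show ?thesis
    using two_layer_representable_UNIV by simp
next
  case False
  \<comment> \<open>The shift by \<open>a\<close> is the center of the ball and not a bias. The root
    is harmless at radius 1, since \<open>sqrt t \<le> 1\<close> iff
    \<open>t \<le> 1\<close>.\<close>
  have "two_layer_representable N {c \<in> carrier_vec N.
      (\<lambda>x. sqrt (x \<bullet> (S *\<^sub>v x))) (map_vec (\<lambda>x. x) (1\<^sub>m N *\<^sub>v c + 0\<^sub>v N) - a) \<le> 1}"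
    using False a S
    by (intro two_layer_representable_one_layer is_norm_sym_pos_def piecewise_affine_ident) auto
  moreover have "map_vec (\<lambda>x. x) v = v" for v :: "real vec"
    by auto
  ultimately show ?thesis
    by (simp cong: conj_cong)
qed

lemma two_layer_representable_polyhedron:
  assumes A: "A \<in> carrier_mat p N" and b: "b \<in> carrier_vec p"
  shows "two_layer_representable N {c \<in> carrier_vec N. A *\<^sub>v c \<le> b}"
proof -
  define ws where "ws = map (\<lambda>i. (row A i, - b $ i)) [0..<p]"
  \<comment> \<open>The shape \<open>x + - y\<close> is that of \<open>w \<bullet> c + q\<close> at
    \<open>q = - b $ i\<close>; the simp set below is reduced to preserve it.\<close>
  have "max 0 (x + - y) = 0 \<longleftrightarrow> x \<le> y" for x y :: real
    by auto
  then have "A *\<^sub>v c \<le> b \<longleftrightarrow> (\<forall>(w, q) \<in> set ws. max 0 (w \<bullet> c + q) = 0)" for c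
    using A b by (auto simp: ws_def less_eq_vec_def simp del: add_uminus_conv_diff)
  moreover have "fst ` set ws \<subseteq> carrier_vec N"
    using A by (auto simp: ws_def)
  ultimately show ?thesis
    using two_layer_representable_zero_set[OF continuous_on_max_0 piecewise_affine_max_0]
    by simp
qed

text \<open>All neurons of a layer share one activation function, so the equations must be tested by
  the same \<open>s\<close> that tests for 0 and 1.\<close>

lemma two_layer_representable_binary_solutions:
  assumes A: "A \<in> carrier_mat p N" and b: "b \<in> carrier_vec p"
  shows "two_layer_representable N
    {c \<in> carrier_vec N. (\<forall>i<N. c $ i \<in> {0, 1}) \<and> A *\<^sub>v c = b}"
proof -
  define s :: "real \<Rightarrow> real" where "s x = \<bar>x - 1/2\<bar> - 1/2" for x
  have s: "s x = 0 \<longleftrightarrow> x = 0 \<or> x = 1" for x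
    by (auto simp: s_def abs_if)
  \<comment> \<open>The first condition leaves 0 and 1 for \<open>r\<close>, the second 0 and -1;
    only 0 is common to both.\<close>
  have "s r = 0 \<and> s (- r) = 0 \<longleftrightarrow> r = 0" for r
    by (auto simp: s)
  then have s_eq: "s (x + - y) = 0 \<and> s (- x + y) = 0 \<longleftrightarrow> x = y" for x y
    by (metis add.inverse_inverse add_eq_0_iff2 minus_add_distrib neg_equal_iff_equal)
  \<comment> \<open>The unit vectors read off the coordinates; each row of the system enters once
    with either sign, for \<open>N + 2 * p\<close> neurons in total.\<close>
  define ws where "ws = map (\<lambda>i. (unit_vec N i, 0)) [0..<N] @
    map (\<lambda>i. (row A i, - b $ i)) [0..<p] @ map (\<lambda>i. (- row A i, b $ i)) [0..<p]"
  have "(\<forall>i<N. c $ i \<in> {0, 1}) \<and> A *\<^sub>v c = b \<longleftrightarrow> (\<forall>(w, q) \<in> set ws. s (w \<bullet> c + q) = 0)"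
    if c: "c \<in> carrier_vec N" for c
  proof -
    have "(\<forall>(w, q) \<in> set ws. s (w \<bullet> c + q) = 0) \<longleftrightarrow> (\<forall>i<N. s (c $ i) = 0) \<and>
        (\<forall>i<p. s (row A i \<bullet> c + - b $ i) = 0 \<and> s (- (row A i \<bullet> c) + b $ i) = 0)"
      using A c by (auto simp: ws_def ball_Un)
    also have "\<dots> \<longleftrightarrow> (\<forall>i<N. c $ i \<in> {0, 1}) \<and> (\<forall>i<p. row A i \<bullet> c = b $ i)"
      using s_eq by (simp add: s)
    also have "(\<forall>i<p. row A i \<bullet> c = b $ i) \<longleftrightarrow> A *\<^sub>v c = b"
      using A b by (auto simp: vec_eq_iff)
    finally show ?thesis
      by blast
  qed
  moreover have "two_layer_representable N
      {c \<in> carrier_vec N. \<forall>(w, q) \<in> set ws. s (w \<bullet> c + q) = 0}"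
  proof (rule two_layer_representable_zero_set)
    show "continuous_on UNIV s"
      unfolding s_def by (intro continuous_intros)
    show "piecewise_affine s"
      unfolding s_def by (rule piecewise_affine_abs)
    show "fst ` set ws \<subseteq> carrier_vec N"
      using A by (auto simp: ws_def)
  qed
  ultimately show ?thesis
    by (simp cong: conj_cong)
qed

theorem lemma4:
  fixes N p :: nat
  shows
    "(\<forall>S a. sym_pos_def N S \<and> a \<in> carrier_vec N \<longrightarrow>
        two_layer_representable N {c \<in> carrier_vec N. (c - a) \<bullet> (S *\<^sub>v (c - a)) \<le> 1}) \<and>
     (\<forall>A b. A \<in> carrier_mat p N \<and> b \<in> carrier_vec p \<longrightarrow>
        two_layer_representable N {c \<in> carrier_vec N. A *\<^sub>v c \<le> b}) \<and>
     (\<forall>A b. A \<in> carrier_mat p N \<and> b \<in> carrier_vec p \<longrightarrow>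
        two_layer_representable N
          {c \<in> carrier_vec N. (\<forall>i<N. c $ i \<in> {0, 1}) \<and> A *\<^sub>v c = b})"
  by (intro conjI allI impI; elim conjE;
    rule two_layer_representable_ellipsoid two_layer_representable_polyhedron
      two_layer_representable_binary_solutions; assumption)

end
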